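(* Let $S$ be a non-degenerate triangle in $\mathbb{R}^3$ with vertices $\mathbf{x}_1,\mathbf{x}_2,\mathbf{x}_3$, oriented edge vectors $\mathbf{l}_1=\mathbf{x}_2-\mathbf{x}_1$, $\mathbf{l}_2=\mathbf{x}_3-\mathbf{x}_2$, $\mathbf{l}_3=\mathbf{x}_1-\mathbf{x}_3$, edges $C_1,C_2,C_3$ of lengths $l_j=|\mathbf{l}_j|$, and half-perimeter $p=\frac12(l_1+l_2+l_3)$. Put, for $i\ne j$, $H_{ij}=\int_{C_i}\int_{C_j}\frac{1}{|\mathbf{x}-\mathbf{y}|}\,dC(\mathbf{y})\,dC(\mathbf{x})$, and set $H_{ii}=0$. Then $$M'_{val}:=-\sum_{i=1}^3\sum_{j=1}^3\frac{\mathbf{l}_i\cdot\mathbf{l}_j}{l_il_j}H_{ij}=2\sum_{j=1}^3l_j\ln\frac{p}{p-l_j}.$$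
   Context: $M'_{val}$ is the regularized value of the self-action hypersingular Galerkin integral of the Laplace kernel (source and receiver triangles coincide), obtained by setting the divergent common-edge contributions $H_{ii}$ to zero. $dC$ denotes arc length. *)

theory Defs
  imports "HOL-Analysis.Analysis"
begin

definition arclength_integral :: "(real \<Rightarrow> 'a::real_normed_vector) \<Rightarrow> ('a \<Rightarrow> real) \<Rightarrow> real" where
  "arclength_integral g f =
     integral {0..1} (\<lambda>t. f (g t) * norm (vector_derivative g (at t within {0..1})))"

text \<open>A triangle is given by its vertices \<open>X 1\<close>, \<open>X 2\<close>, \<open>X 3\<close>; other values of \<open>X\<close> play no role.
  For \<open>j\<close> in \<open>{1..3}\<close>, \<open>j mod 3 + 1\<close> is the cyclic successor of \<open>j\<close>.\<close>

definition edge_vec :: "(nat \<Rightarrow> real^3) \<Rightarrow> nat \<Rightarrow> real^3" where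
  "edge_vec X j = X (j mod 3 + 1) - X j"

definition edge_path :: "(nat \<Rightarrow> real^3) \<Rightarrow> nat \<Rightarrow> real \<Rightarrow> real^3" where
  "edge_path X j = linepath (X j) (X (j mod 3 + 1))"

definition edge_len :: "(nat \<Rightarrow> real^3) \<Rightarrow> nat \<Rightarrow> real" where
  "edge_len X j = norm (edge_vec X j)"

definition half_perimeter :: "(nat \<Rightarrow> real^3) \<Rightarrow> real" where
  "half_perimeter X = (edge_len X 1 + edge_len X 2 + edge_len X 3) / 2"

text \<open>For \<open>i \<noteq> j\<close> the integrand is unbounded at the common vertex of the two edges. The inner
  integral diverges only when \<open>x\<close> is that vertex, a null set for the outer integral. The
  diagonal terms diverge and are set to \<open>0\<close>.\<close>

definition edge_H :: "(nat \<Rightarrow> real^3) \<Rightarrow> nat \<Rightarrow> nat \<Rightarrow> real" where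
  "edge_H X i j =
     (if i = j then 0
      else arclength_integral (edge_path X i)
             (\<lambda>x. arclength_integral (edge_path X j) (\<lambda>y. 1 / norm (x - y))))"

definition M_val' :: "(nat \<Rightarrow> real^3) \<Rightarrow> real" where
  "M_val' X =
     - (\<Sum>i=1..3. \<Sum>j=1..3.
          (edge_vec X i \<bullet> edge_vec X j) / (edge_len X i * edge_len X j) * edge_H X i j)"

end

theory Submission
  imports Defs
begin

text \<open>The integral of \<open>1/r\<close> over two sides \<open>a, b\<close> of a triangle that meet at a vertex is
  \<open>a ln (p/(p-b)) + b ln (p/(p-a))\<close>. Its coefficient in the sum is twice the cosine of the enclosed
  angle, and projecting the other two sides onto a given one recovers the length of that side.\<close>

section \<open>Line integrals over straight segments\<close>

lemma has_integral_rescale_unit_interval: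
  fixes g :: "real \<Rightarrow> real"
  assumes "0 < a" and "(g has_integral I) {0..a}"
  shows "((\<lambda>t. g (t * a) * a) has_integral I) {0..1}"
proof -
  have "((\<lambda>t. g (a * t + 0)) has_integral (1 / a) * I) {0..1}"
    using has_integral_affinity'[of g I 0 a a 0] assms by (simp add: divide_simps)
  from has_integral_mult_left[OF this, of a] show ?thesis
    using assms(1) by (simp add: mult.commute)
qed

lemma arclength_integral_linepath_unit:
  "arclength_integral (linepath P Q) f = integral {0..1} (\<lambda>t. f (linepath P Q t) * norm (Q - P))"
  unfolding arclength_integral_def
  by (intro integral_cong) (simp add: vector_derivative_linepath_within)

text \<open>Endpoints form a null set, so \<open>f\<close> is constrained only at interior points.
  This lets the outer integrand be arbitrary at the common vertex, where the inner integral
  diverges.\<close>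

lemma arclength_integral_linepath:
  assumes "P \<noteq> Q" and g: "(g has_integral I) {0..norm (Q - P)}"
    and f: "\<And>t. \<lbrakk>0 < t; t < 1\<rbrakk> \<Longrightarrow> f (linepath P Q t) = g (t * norm (Q - P))"
  shows "arclength_integral (linepath P Q) f = I"
proof -
  have "((\<lambda>t. f (linepath P Q t) * norm (Q - P)) has_integral I) {0..1}"
    by (rule has_integral_spike_finite[where S = "{0, 1}",
          OF _ _ has_integral_rescale_unit_interval[OF _ g]])
      (use assms(1) f in auto)
  then show ?thesis
    unfolding arclength_integral_linepath_unit by (rule integral_unique)
qed

text \<open>The edges run cyclically, so of two edges meeting at a vertex one ends there. Reversal
  makes both start at it.\<close>

lemma arclength_integral_linepath_commute:
  "arclength_integral (linepath P Q) f = arclength_integral (linepath Q P) f"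
proof -
  define h where "h t = f (linepath P Q t)" for t
  have "integral {0..1} h = integral {-1..0} (\<lambda>t. h (-t))"
    using Henstock_Kurzweil_Integration.integral_reflect_real[of 1 0 h] by simp
  also have "\<dots> = integral {0..1} (\<lambda>t. h (1 - t))"
    using integral_shift_real_ivl[of "-1" "-1" 0 "\<lambda>t. h (-t)"] by simp
  also have "(\<lambda>t. h (1 - t)) = (\<lambda>t. f (linepath Q P t))"
    by (simp add: h_def linepath_def algebra_simps)
  finally show ?thesis
    by (simp add: arclength_integral_linepath_unit h_def norm_minus_commute)
qed

section \<open>Inverse distance integrals in terms of side lengths and the enclosed cosine\<close>

text \<open>The squares differ by \<open>s\<^sup>2 * (1 - k\<^sup>2)\<close>, the squared height
  over the line carrying \<open>t\<close> when \<open>k\<close> is the cosine of the enclosed angle.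
  The bound keeps the later logarithms' arguments positive.\<close>

lemma law_of_cosines_root_gt:
  fixes s t k :: real
  assumes "\<bar>k\<bar> < 1" "s \<noteq> 0"
  shows "\<bar>t - s * k\<bar> < sqrt (s\<^sup>2 + t\<^sup>2 - 2 * s * t * k)"
proof (rule real_less_rsqrt)
  have "0 < s\<^sup>2 * (1 - k\<^sup>2)"
    using assms by (simp add: abs_square_less_1)
  then show "\<bar>t - s * k\<bar>\<^sup>2 < s\<^sup>2 + t\<^sup>2 - 2 * s * t * k"
    by (simp add: power2_eq_square algebra_simps)
qed

text \<open>With \<open>r\<close> the root, \<open>r' = (t - s * k) / r\<close>, so the argument of
  \<open>ln\<close> has derivative \<open>(t - s * k + r) / r\<close>, which is itself divided by
  \<open>r\<close>.\<close>

lemma law_of_cosines_root_deriv: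
  fixes s t k :: real
  assumes "\<bar>k\<bar> < 1" "s \<noteq> 0"
  shows "((\<lambda>t. ln (t - s * k + sqrt (s\<^sup>2 + t\<^sup>2 - 2 * s * t * k))) has_real_derivative
           1 / sqrt (s\<^sup>2 + t\<^sup>2 - 2 * s * t * k)) (at t)"
proof -
  define r where "r = sqrt (s\<^sup>2 + t\<^sup>2 - 2 * s * t * k)"
  have gt: "\<bar>t - s * k\<bar> < r"
    using law_of_cosines_root_gt[OF assms] by (simp add: r_def)
  then have pos: "0 < r" "0 < t - s * k + r"
    by linarith+
  then have "0 < s\<^sup>2 + t\<^sup>2 - 2 * s * t * k"
    by (simp add: r_def)
  then have "((\<lambda>t. ln (t - s * k + sqrt (s\<^sup>2 + t\<^sup>2 - 2 * s * t * k))) has_real_derivative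
      (1 + (2 * t - 2 * s * k) * (1 / (2 * r))) / (t - s * k + r)) (at t)"
    using pos unfolding r_def
    by (auto intro!: derivative_eq_intros simp: field_simps)
  also have "(1 + (2 * t - 2 * s * k) * (1 / (2 * r))) / (t - s * k + r) = 1 / r"
    using pos by (simp add: divide_simps)
  finally show ?thesis
    by (simp add: r_def)
qed

text \<open>Supplies continuity up to the common vertex for the antiderivative of the outer
  integral; the only delicate point is 0.\<close>

lemma continuous_on_mult_ln: "continuous_on {0..} (\<lambda>x::real. x * ln x)"
  unfolding continuous_on_def
proof
  fix x :: real
  assume "x \<in> {0..}"
  show "((\<lambda>x. x * ln x) \<longlongrightarrow> x * ln x) (at x within {0..})"
  proof (cases "x = 0")
    case True
    have "((\<lambda>x::real. x * ln x) \<longlongrightarrow> 0) (at_right 0)"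
      by real_asymp
    then show ?thesis
      using True by (simp add: at_within_Ici_at_right)
  next
    case False
    then show ?thesis
      by (intro tendsto_intros) auto
  qed
qed

lemma integral_inverse_distance_to_segment:
  fixes s b k :: real
  assumes "\<bar>k\<bar> < 1" "0 < s" "0 < b"
  shows "((\<lambda>t. 1 / sqrt (s\<^sup>2 + t\<^sup>2 - 2 * s * t * k)) has_integral
           (ln (b - s * k + sqrt (s\<^sup>2 + b\<^sup>2 - 2 * s * b * k)) - ln (s * (1 - k)))) {0..b}"
proof -
  have "((\<lambda>t. 1 / sqrt (s\<^sup>2 + t\<^sup>2 - 2 * s * t * k)) has_integral
      (ln (b - s * k + sqrt (s\<^sup>2 + b\<^sup>2 - 2 * s * b * k))
       - ln (0 - s * k + sqrt (s\<^sup>2 + 0\<^sup>2 - 2 * s * 0 * k)))) {0..b}"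
    using assms
    by (intro fundamental_theorem_of_calculus)
      (auto simp flip: has_real_derivative_iff_has_vector_derivative
        intro!: DERIV_subset[OF law_of_cosines_root_deriv])
  then show ?thesis
    using assms by (simp add: algebra_simps)
qed

text \<open>The inner integral \<open>G(s, b)\<close> is homogeneous of degree \<open>0\<close>, so Euler's identity
  \<open>s G\<^sub>s = - b G\<^sub>b = - b / r(s, b)\<close> gives the antiderivative \<open>s G + b \<integral> ds / r(s, b)\<close>. At \<open>s = 0\<close>
  it is only continuous, which suffices for the fundamental theorem.\<close>
lemma integral_inverse_distance_two_segments:
  fixes a b k :: real
  assumes k: "\<bar>k\<bar> < 1" and a: "0 < a" and b: "0 < b"
  defines "c \<equiv> sqrt (a\<^sup>2 + b\<^sup>2 - 2 * a * b * k)"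
  shows "((\<lambda>s. ln (b - s * k + sqrt (s\<^sup>2 + b\<^sup>2 - 2 * s * b * k)) - ln (s * (1 - k))) has_integral
           (a * (ln (b - a * k + c) - ln (a * (1 - k)))
            + b * (ln (a - b * k + c) - ln (b * (1 - k))))) {0..a}"
proof -
  define r where "r s = sqrt (s\<^sup>2 + b\<^sup>2 - 2 * s * b * k)" for s
  \<comment> \<open>\<open>s * ln (s * (1 - k))\<close> is split so that \<open>s * ln s\<close> is
    the only term singular at 0. The last term is \<open>b\<close> times an antiderivative of
    \<open>1 / r s\<close>.\<close>
  define F where "F s = s * ln (b - s * k + r s) - s * ln s - s * ln (1 - k)
      + b * ln (s - b * k + r s)" for s
  have rt: "\<bar>s - b * k\<bar> < r s" for s
    using law_of_cosines_root_gt[OF k, of b s] b by (simp add: r_def algebra_simps)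
  have rpos: "0 < r s" and p2: "0 < s - b * k + r s" for s
    using rt[of s] by linarith+
  have rsq: "(r s)\<^sup>2 = s\<^sup>2 + b\<^sup>2 - 2 * s * b * k" for s
    using rpos[of s] by (auto simp: r_def)
  have p1: "0 < b - s * k + r s" for s
  proof (cases "s = 0")
    case True
    then show ?thesis using rpos[of s] b by simp
  next
    case False
    then show ?thesis
      using law_of_cosines_root_gt[OF k, of s b] by (auto simp: r_def abs_less_iff)
  qed
  have pk: "0 < 1 - k"
    using k by linarith
  have lnk: "ln (x * (1 - k)) = ln x + ln (1 - k)" if "0 < x" for x
    using that pk by (simp add: ln_mult)
  have contr: "continuous_on A r" for A
    unfolding r_def by (intro continuous_intros)
  have cont: "continuous_on {0..a} F"
    unfolding F_def
    using p1 p2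
    by (intro continuous_intros contr continuous_on_subset[OF continuous_on_mult_ln])
      (auto simp: less_imp_neq[symmetric] order_less_imp_not_eq2)
  have deriv: "(F has_real_derivative ln (b - s * k + r s) - ln (s * (1 - k))) (at s)"
    if s: "s \<in> {0<..<a}" for s
  proof -
    have dr: "(r has_real_derivative (s - b * k) / r s) (at s)"
      using rpos[of s] unfolding r_def
      by (auto intro!: derivative_eq_intros simp: field_simps)
    define g where "g s = ln (s - b * k + r s)" for s
    have dg: "(g has_real_derivative 1 / r s) (at s)"
      unfolding g_def using law_of_cosines_root_deriv[OF k, of b s] b by (simp add: r_def algebra_simps)
    have "(F has_real_derivative
        (ln (b - s * k + r s) + s * ((- k + (s - b * k) / r s) / (b - s * k + r s)))
        - (ln s + 1) - ln (1 - k) + b * (1 / r s)) (at s)"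
      unfolding F_def g_def[symmetric] using s p1[of s]
      by (auto intro!: derivative_eq_intros dr dg)
    \<comment> \<open>The 1 cancels against the derivative of \<open>s * ln s\<close>, and
      \<open>- b / r s\<close> against that of the last term of \<open>F\<close>; only the integrand
      survives.\<close>
    moreover have "s * ((- k + (s - b * k) / r s) / (b - s * k + r s)) = 1 - b / r s"
    proof -
      have "s * (- k * r s + (s - b * k)) = (r s - b) * (b - s * k + r s)"
        using rsq[of s] by (simp add: power2_eq_square algebra_simps)
      moreover have "- k + (s - b * k) / r s = (- k * r s + (s - b * k)) / r s"
        "1 - b / r s = (r s - b) / r s"
        using rpos[of s] by (simp_all add: field_simps)
      ultimately show ?thesis
        using rpos[of s] p1[of s] by (simp add: divide_simps)
    qed
    ultimately show ?thesis
      using s by (elim DERIV_cong) (simp add: lnk)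
  qed
  have "((\<lambda>s. ln (b - s * k + r s) - ln (s * (1 - k))) has_integral (F a - F 0)) {0..a}"
    using a cont deriv
    by (intro fundamental_theorem_of_calculus_interior)
      (auto simp flip: has_real_derivative_iff_has_vector_derivative)
  moreover have "F a - F 0 = a * (ln (b - a * k + c) - ln (a * (1 - k)))
      + b * (ln (a - b * k + c) - ln (b * (1 - k)))"
  proof -
    have F0: "F 0 = b * ln (b * (1 - k))"
      using b by (simp add: F_def r_def algebra_simps)
    have Fa: "F a = a * (ln (b - a * k + c) - ln (a * (1 - k))) + b * ln (a - b * k + c)"
      unfolding lnk[OF a] by (simp add: F_def r_def c_def algebra_simps)
    show ?thesis
      unfolding F0 Fa by (simp add: right_diff_distrib)
  qed
  ultimately show ?thesis
    by (simp add: r_def)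
qed

text \<open>Cross-multiplying the two quotients under \<open>ln\<close> leaves exactly the law of
  cosines. This removes the angle from the boundary terms.\<close>

lemma law_of_cosines_ln_half_perimeter:
  fixes a b c k :: real
  assumes k: "\<bar>k\<bar> < 1" and a: "0 < a" and b: "0 < b"
    and c: "c = sqrt (a\<^sup>2 + b\<^sup>2 - 2 * a * b * k)" and p: "p = (a + b + c) / 2"
  shows "ln (a - b * k + c) - ln (b * (1 - k)) = ln (p / (p - a))"
proof -
  have gt: "\<bar>b - a * k\<bar> < c" "\<bar>a - b * k\<bar> < c"
    using law_of_cosines_root_gt[OF k, of a b] law_of_cosines_root_gt[OF k, of b a] a b
    by (simp_all add: c algebra_simps)
  have csq: "c\<^sup>2 = a\<^sup>2 + b\<^sup>2 - 2 * a * b * k"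
    using le_less_trans[OF abs_ge_zero gt(1)] by (simp add: c)
  have pk: "0 < 1 - k"
    using k by linarith
  \<comment> \<open>The strict triangle inequality \<open>a < b + c\<close>, which makes
    \<open>p - a\<close> positive.\<close>
  have "a - b < a - b * k"
    using b pk by simp
  also have "\<dots> < c"
    using gt by linarith
  finally have pa: "0 < p - a"
    by (simp add: p)
  have "(a - b * k + c) * (b + c - a) - b * (1 - k) * (a + b + c) =
      c\<^sup>2 - (a\<^sup>2 + b\<^sup>2 - 2 * a * b * k)"
    by (simp add: power2_eq_square algebra_simps)
  then have "(a - b * k + c) * (b + c - a) = b * (1 - k) * (a + b + c)"
    using csq by simp
  then have "(a - b * k + c) / (b * (1 - k)) = p / (p - a)"
    using pa b pk by (simp add: p divide_simps) (simp add: algebra_simps)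
  moreover have "ln ((a - b * k + c) / (b * (1 - k))) = ln (a - b * k + c) - ln (b * (1 - k))"
    using gt b pk by (subst ln_divide_pos) auto
  ultimately show ?thesis
    by simp
qed

section \<open>Pairs of edges of a triangle in Euclidean space\<close>

text \<open>Both sides are parametrised by distance from the common vertex \<open>V\<close>, and
  \<open>k\<close> is the cosine of the angle there. Non-collinearity makes Cauchy-Schwarz strict,
  hence \<open>\<bar>k\<bar> < 1\<close>.\<close>

lemma integral_inverse_distance_two_edges:
  fixes V Q R :: "'a::euclidean_space"
  assumes nc: "\<not> collinear {V, Q, R}"
  defines "p \<equiv> (norm (Q - V) + norm (R - V) + norm (R - Q)) / 2"
  shows "arclength_integral (linepath V Q)
           (\<lambda>x. arclength_integral (linepath V R) (\<lambda>y. 1 / norm (x - y))) =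
         norm (Q - V) * ln (p / (p - norm (R - V))) + norm (R - V) * ln (p / (p - norm (Q - V)))"
proof -
  define a b k where "a = norm (Q - V)" and "b = norm (R - V)"
    and "k = ((Q - V) \<bullet> (R - V)) / (a * b)"
  have ne: "V \<noteq> Q" "V \<noteq> R"
    using nc by (auto simp: insert_commute)
  then have a: "0 < a" and b: "0 < b"
    by (auto simp: a_def b_def)
  have "\<not> collinear {0, Q - V, R - V}"
    using nc collinear_3[of Q V R] by (simp add: insert_commute)
  then have "\<bar>(Q - V) \<bullet> (R - V)\<bar> < a * b"
    using norm_cauchy_schwarz_equal[of "Q - V" "R - V"] Cauchy_Schwarz_ineq2[of "Q - V" "R - V"]
    by (auto simp: a_def b_def)
  then have k: "\<bar>k\<bar> < 1"
    using a b by (simp add: k_def abs_mult)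
  have dist: "norm (linepath V Q s - linepath V R t) =
      sqrt ((s * a)\<^sup>2 + (t * b)\<^sup>2 - 2 * (s * a) * (t * b) * k)" for s t
  proof -
    define u w where "u = Q - V" and "w = R - V"
    have "linepath V Q s - linepath V R t = s *\<^sub>R u - t *\<^sub>R w"
      by (simp add: u_def w_def linepath_def algebra_simps)
    moreover have "(norm (s *\<^sub>R u - t *\<^sub>R w))\<^sup>2 =
        (s * a)\<^sup>2 + (t * b)\<^sup>2 - 2 * (s * a) * (t * b) * k"
    proof -
      have "u \<bullet> w = a * b * k" "u \<bullet> u = a\<^sup>2" "w \<bullet> w = b\<^sup>2"
        using a b by (simp_all add: k_def u_def w_def a_def b_def power2_norm_eq_inner)
      then show ?thesis
        unfolding power2_norm_eq_inner
        by (simp add: inner_commute[of w u] power2_eq_square algebra_simps)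
    qed
    ultimately show ?thesis
      by (simp add: real_sqrt_unique)
  qed
  define c where "c = norm (R - Q)"
  have c: "c = sqrt (a\<^sup>2 + b\<^sup>2 - 2 * a * b * k)"
    using dist[of 1 1] by (simp add: c_def linepath_def norm_minus_commute)
  have c': "c = sqrt (b\<^sup>2 + a\<^sup>2 - 2 * b * a * k)"
    by (simp add: c algebra_simps)
  have inner: "arclength_integral (linepath V R) (\<lambda>y. 1 / norm (linepath V Q s - y)) =
      ln (b - s * a * k + sqrt ((s * a)\<^sup>2 + b\<^sup>2 - 2 * (s * a) * b * k)) - ln (s * a * (1 - k))"
    if "0 < s" for s
    by (rule arclength_integral_linepath[OF ne(2), folded b_def,
          OF integral_inverse_distance_to_segment[OF k _ b, of "s * a"]])
      (use a that in \<open>simp_all add: dist\<close>)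
  have "arclength_integral (linepath V Q)
      (\<lambda>x. arclength_integral (linepath V R) (\<lambda>y. 1 / norm (x - y))) =
      a * (ln (b - a * k + c) - ln (a * (1 - k))) + b * (ln (a - b * k + c) - ln (b * (1 - k)))"
    by (rule arclength_integral_linepath[OF ne(1), folded a_def,
          OF integral_inverse_distance_two_segments[OF k a b, folded c]])
      (simp add: inner)
  also have "ln (b - a * k + c) - ln (a * (1 - k)) = ln (p / (p - b))"
    by (rule law_of_cosines_ln_half_perimeter[OF k b a c']) (simp add: p_def a_def b_def c_def)
  also have "ln (a - b * k + c) - ln (b * (1 - k)) = ln (p / (p - a))"
    by (rule law_of_cosines_ln_half_perimeter[OF k a b c]) (simp add: p_def a_def b_def c_def)
  finally show ?thesis
    by (simp add: a_def b_def)
qed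

text \<open>Each order of integration is evaluated directly from the common vertex \<open>Q\<close>,
  without interchanging integrals: the first reverses the outer edge, the second the inner
  one.\<close>

lemma integral_inverse_distance_consecutive_edges:
  fixes P Q R :: "'a::euclidean_space"
  assumes nc: "\<not> collinear {P, Q, R}"
    and p: "p = (norm (Q - P) + norm (R - Q) + norm (P - R)) / 2"
  defines "h \<equiv> norm (Q - P) * ln (p / (p - norm (R - Q))) + norm (R - Q) * ln (p / (p - norm (Q - P)))"
  shows "arclength_integral (linepath P Q)
           (\<lambda>x. arclength_integral (linepath Q R) (\<lambda>y. 1 / norm (x - y))) = h"
    and "arclength_integral (linepath Q R)
           (\<lambda>x. arclength_integral (linepath P Q) (\<lambda>y. 1 / norm (x - y))) = h"
proof -
  have nc': "\<not> collinear {Q, P, R}" "\<not> collinear {Q, R, P}"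
    using nc by (simp_all add: insert_commute)
  have p': "p = (norm (P - Q) + norm (R - Q) + norm (R - P)) / 2"
    "p = (norm (R - Q) + norm (P - Q) + norm (P - R)) / 2"
    by (simp_all add: p norm_minus_commute)
  show "arclength_integral (linepath P Q)
      (\<lambda>x. arclength_integral (linepath Q R) (\<lambda>y. 1 / norm (x - y))) = h"
    using integral_inverse_distance_two_edges[OF nc'(1), folded p'(1)]
    by (subst arclength_integral_linepath_commute) (simp add: h_def norm_minus_commute)
  show "arclength_integral (linepath Q R)
      (\<lambda>x. arclength_integral (linepath P Q) (\<lambda>y. 1 / norm (x - y))) = h"
    using integral_inverse_distance_two_edges[OF nc'(2), folded p'(2)]
    by (subst arclength_integral_linepath_commute[of P Q])
      (simp add: h_def norm_minus_commute add.commute)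
qed

section \<open>Summation over all pairs of edges\<close>

text \<open>Summing \<open>e\<^sub>i \<bullet> e\<^sub>j (L\<^sub>i / l\<^sub>i + L\<^sub>j / l\<^sub>j)\<close> over \<open>i \<noteq> j\<close> collapses because
  \<open>e\<^sub>1 + e\<^sub>2 + e\<^sub>3 = 0\<close> makes the off-diagonal part of each row equal to \<open>- l\<^sub>j\<^sup>2\<close>.\<close>
theorem mainTheorem5:
  fixes X :: "nat \<Rightarrow> real^3"
  assumes "\<not> collinear {X 1, X 2, X 3}"
  shows "M_val' X =
    2 * (\<Sum>j=1..3. edge_len X j * ln (half_perimeter X / (half_perimeter X - edge_len X j)))"
proof -
  define e where "e = edge_vec X"
  define l where "l = edge_len X"
  define L where "L j = ln (half_perimeter X / (half_perimeter X - l j))" for j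
  have succ: "Suc (Suc 0) = 2"
    by simp
  have e: "e 1 = X 2 - X 1" "e 2 = X 3 - X 2" "e 3 = X 1 - X 3"
    by (simp_all add: e_def edge_vec_def succ)
  have l: "l j = norm (e j)" for j
    by (simp add: l_def e_def edge_len_def)
  have "X 1 \<noteq> X 2" "X 2 \<noteq> X 3" "X 3 \<noteq> X 1"
    using assms by (auto simp: insert_commute)
  then have lpos: "0 < l 1" "0 < l 2" "0 < l 3"
    by (auto simp: l e simp del: One_nat_def)
  have p: "half_perimeter X = (norm (X 2 - X 1) + norm (X 3 - X 2) + norm (X 1 - X 3)) / 2"
    "half_perimeter X = (norm (X 3 - X 2) + norm (X 1 - X 3) + norm (X 2 - X 1)) / 2"
    "half_perimeter X = (norm (X 1 - X 3) + norm (X 2 - X 1) + norm (X 3 - X 2)) / 2"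
    by (simp_all add: half_perimeter_def edge_len_def edge_vec_def succ)
  have nc: "\<not> collinear {X 2, X 3, X 1}" "\<not> collinear {X 3, X 1, X 2}"
    using assms by (simp_all add: insert_commute)
  \<comment> \<open>Three cyclic shifts of the vertices, each giving both orders of integration,
    cover all six off-diagonal pairs.\<close>
  have H: "edge_H X 1 2 = l 1 * L 2 + l 2 * L 1" "edge_H X 2 1 = l 1 * L 2 + l 2 * L 1"
    "edge_H X 2 3 = l 2 * L 3 + l 3 * L 2" "edge_H X 3 2 = l 2 * L 3 + l 3 * L 2"
    "edge_H X 3 1 = l 3 * L 1 + l 1 * L 3" "edge_H X 1 3 = l 3 * L 1 + l 1 * L 3"
    using integral_inverse_distance_consecutive_edges[OF assms p(1)]
      integral_inverse_distance_consecutive_edges[OF nc(1) p(2)]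
      integral_inverse_distance_consecutive_edges[OF nc(2) p(3)]
    by (simp_all add: edge_H_def edge_path_def L_def l e[simplified] succ)
  have diag: "edge_H X j j = 0" for j
    by (simp add: edge_H_def)
  \<comment> \<open>Dividing \<open>L j\<close> by \<open>l j\<close> absorbs the normalising
    lengths, so the sum becomes linear in \<open>w\<close> with inner products as
    coefficients.\<close>
  define w where "w j = L j / l j" for j
  have row: "(e i \<bullet> e j) / (l i * l j) * (l i * L j + l j * L i) = (e i \<bullet> e j) * (w i + w j)"
    if "i \<in> {1,2,3}" "j \<in> {1,2,3}" for i j
    using that lpos by (auto simp: w_def field_simps)
  have Lw: "l j * L j = (e j \<bullet> e j) * w j" if "j \<in> {1,2,3}" for j
    using that lpos by (auto simp: w_def l power2_norm_eq_inner[symmetric] power2_eq_square)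
  have set3: "{1..3} = {1, 2, 3::nat}"
    by auto
  \<comment> \<open>Closure of the triangle; eliminating \<open>e 3\<close> turns the remaining
    identity into one between polynomials in inner products of \<open>e 1\<close> and
    \<open>e 2\<close>.\<close>
  have e3: "e 3 = - e 1 - e 2"
    by (simp add: e[simplified])
  have "M_val' X = - 2 * ((e 1 \<bullet> e 2) * (w 1 + w 2) + (e 2 \<bullet> e 3) * (w 2 + w 3)
      + (e 3 \<bullet> e 1) * (w 3 + w 1))"
    using row[of 1 2] row[of 2 3] row[of 3 1]
    by (simp add: M_val'_def set3 H diag inner_commute mult.commute add.commute
        flip: e_def l_def del: One_nat_def)
  also have "\<dots> = 2 * ((e 1 \<bullet> e 1) * w 1 + (e 2 \<bullet> e 2) * w 2 + (e 3 \<bullet> e 3) * w 3)"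
    unfolding e3
    by (simp add: inner_diff_left inner_diff_right inner_commute algebra_simps)
  also have "\<dots> = 2 * (\<Sum>j=1..3. l j * L j)"
    by (simp add: Lw set3 del: One_nat_def)
  finally show ?thesis
    by (simp add: l_def L_def)
qed

end
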